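(* Every linear DeBruijn sequence is a double helix.
   Context: All strings are over the alphabet $\{0,1\}$, identified with the field $\mathbb{Z}_2$. A DeBruijn string of order $n$ is a binary string of minimal length (namely $2^n+n-1$) that contains every binary string of length $n$ as a (contiguous) substring. A DeBruijn cycle of order $n$ is a cyclic binary string of length $2^n$ in which every binary string of length $n$ occurs (cyclically); reading it once around from any starting point and then appending the first $n-1$ digits read yields an associated DeBruijn string of order $n$. Linear DeBruijn sequences: consider a linear recurrence $a_k = c_1a_{k-1}+c_2a_{k-2}+\dots+c_na_{k-n}$, $k=0,1,\dots$, over $\mathbb{Z}_2$, with coefficients $c_i\in\mathbb{Z}_2$ and given initial values $a_{-1},\dots,a_{-n}$. A binary sequence so produced is called a PN sequence (of order $n$) if it has the maximal possible period $2^n-1$. A full period of a PN sequence, viewed cyclically, contains every binary string of length $n$ except the all-zero one; inserting an extra $0$ at the beginning of the unique string of $n-1$ zeros in this cycle yields a DeBruijn cycle of order $n$. The cycles obtained in this way are called linear DeBruijn cycles, and their associated DeBruijn strings are called linear DeBruijn sequences. The DeBruijn graph $\mathcal{B}^n$ is the directed graph whose vertices are the binary strings of length $n$, with an edge from $x\rho$ (with $x$ a digit, $|\rho|=n-1$) to each of $\rho0$ and $\rho1$, and no other edges. A DeBruijn string $X$ of order $n$ begins and ends with the same string of length $n-1$, so the path visiting in order its successive substrings of length $n$ closes up, by the edge from its last vertex to its first, to a Hamiltonian circuit of $\mathcal{B}^n$. $X$ is called a double helix if the graph obtained from $\mathcal{B}^n$ by removing the edges of this circuit has exactly 3 connected components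 (described as the minimum number possible), including the loop from the all-zero string of length $n$ to itself and the loop from the all-one string of length $n$ to itself. A DeBruijn cycle is also called a double helix if the associated DeBruijn string is a double helix.
   Formalization: The order n is assumed to be at least 2; for n = 1 the claim fails, since removing the circuit of the linear DeBruijn string 01 leaves only the two loops, that is 2 components instead of 3. *)

theory Defs
  imports
    "HOL-Library.Z2"
    "HOL-Library.Sublist"
    "Graph_Theory.Graph_Theory"
begin

type_synonym binstring = "bit list"

definition deBruijn_string :: "nat \<Rightarrow> binstring \<Rightarrow> bool" where
  "deBruijn_string n X \<longleftrightarrow>
     length X = 2 ^ n + n - 1 \<and> (\<forall>w. length w = n \<longrightarrow> sublist w X)"

text \<open>A cyclic string is represented by any of the linear strings obtained by reading it once
  around, so \<open>Y\<close> and \<open>rotate m Y\<close> represent the same cyclic string.\<close>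

definition associated_string :: "nat \<Rightarrow> binstring \<Rightarrow> binstring \<Rightarrow> bool" where
  "associated_string n Y X \<longleftrightarrow> (\<exists>m. X = rotate m Y @ take (n - 1) (rotate m Y))"

text \<open>The values \<open>a (-1), \<dots>, a (-n)\<close> are the given initial values and the sequence produced is
  \<open>a 0, a 1, \<dots>\<close>; values of \<open>a\<close> below \<open>-n\<close> are irrelevant.\<close>

definition linear_recurrence :: "nat \<Rightarrow> (nat \<Rightarrow> bit) \<Rightarrow> (int \<Rightarrow> bit) \<Rightarrow> bool" where
  "linear_recurrence n c a \<longleftrightarrow> (\<forall>k\<ge>0. a k = (\<Sum>i=1..n. c i * a (k - int i)))"

definition has_period :: "(nat \<Rightarrow> 'a) \<Rightarrow> nat \<Rightarrow> bool" where
  "has_period s p \<longleftrightarrow> p > 0 \<and> (\<forall>k. s (k + p) = s k)"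

definition least_period :: "(nat \<Rightarrow> 'a) \<Rightarrow> nat \<Rightarrow> bool" where
  "least_period s p \<longleftrightarrow> has_period s p \<and> (\<forall>q. has_period s q \<longrightarrow> p \<le> q)"

definition PN_sequence :: "nat \<Rightarrow> (nat \<Rightarrow> bit) \<Rightarrow> bool" where
  "PN_sequence n s \<longleftrightarrow>
     (\<exists>c a. linear_recurrence n c a \<and> s = (\<lambda>k. a (int k)) \<and> least_period s (2 ^ n - 1))"

text \<open>Here \<open>W\<close> is a full period of the PN sequence, rotated so that its string of \<open>n - 1\<close> zeros
  comes first.\<close>

definition linear_deBruijn_cycle :: "nat \<Rightarrow> binstring \<Rightarrow> bool" where
  "linear_deBruijn_cycle n Y \<longleftrightarrow>
     (\<exists>s W j m. PN_sequence n s \<and> W = rotate j (map s [0..<2 ^ n - 1]) \<and>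
        take (n - 1) W = replicate (n - 1) 0 \<and> Y = rotate m (0 # W))"

definition linear_deBruijn_sequence :: "nat \<Rightarrow> binstring \<Rightarrow> bool" where
  "linear_deBruijn_sequence n X \<longleftrightarrow> (\<exists>Y. linear_deBruijn_cycle n Y \<and> associated_string n Y X)"

definition deBruijn_graph :: "nat \<Rightarrow> binstring pair_pre_digraph" where
  "deBruijn_graph n =
     \<lparr>pverts = {w. length w = n},
      parcs = {(x # r, r @ [y]) | x r y. length r = n - 1}\<rparr>"

text \<open>A string of length \<open>2 ^ n + n - 1\<close> has exactly \<open>2 ^ n\<close> substring positions for length \<open>n\<close>;
  reducing the index modulo \<open>2 ^ n\<close> adds the closing edge from the last vertex to the first.\<close>

definition window :: "nat \<Rightarrow> binstring \<Rightarrow> nat \<Rightarrow> binstring" where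
  "window n X i = take n (drop i X)"

definition circuit_arcs :: "nat \<Rightarrow> binstring \<Rightarrow> (binstring \<times> binstring) set" where
  "circuit_arcs n X = {(window n X i, window n X (Suc i mod 2 ^ n)) | i. i < 2 ^ n}"

definition complement_graph :: "nat \<Rightarrow> binstring \<Rightarrow> binstring pair_pre_digraph" where
  "complement_graph n X =
     \<lparr>pverts = pverts (deBruijn_graph n),
      parcs = parcs (deBruijn_graph n) - circuit_arcs n X\<rparr>"

text \<open>\<open>Digraph_Component.connected\<close> ignores the directions of the arcs.\<close>

definition connected_components :: "('a, 'b) pre_digraph \<Rightarrow> ('a, 'b) pre_digraph set" where
  "connected_components G = {H. pre_digraph.max_subgraph G Digraph_Component.connected H}"

definition loop_graph :: "'a \<Rightarrow> 'a pair_pre_digraph" where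
  "loop_graph v = \<lparr>pverts = {v}, parcs = {(v, v)}\<rparr>"

definition double_helix :: "nat \<Rightarrow> binstring \<Rightarrow> bool" where
  "double_helix n X \<longleftrightarrow> deBruijn_string n X \<and>
     card (connected_components (with_proj (complement_graph n X))) = 3 \<and>
     with_proj (loop_graph (replicate n 0)) \<in> connected_components (with_proj (complement_graph n X)) \<and>
     with_proj (loop_graph (replicate n 1)) \<in> connected_components (with_proj (complement_graph n X))"

end

theory Submission
  imports Defs
begin

text \<open>
  The successive states \<open>T k\<close> of the recurrence run through all nonzero words of length \<open>n\<close>, and the
  circuit follows the arcs \<open>T k \<rightarrow> T (k + 1)\<close>, except for a detour through the zero word. The all-one
  word is not fixed by the recurrence, so the feedback of the all-one word is \<open>0\<close>. Hence adding the
  all-one word to the arcs \<open>T k \<rightarrow> T (k + 1)\<close> yields arcs of the graph that always disagree with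
  those of the recurrence in the last digit. The complement of the circuit therefore follows the
  orbit of the complemented states, which visits every word but the all-one word; removing the zero
  word from that orbit leaves a path through all words other than the two constant ones, while the
  two constant words keep only their loops.
\<close>

section \<open>Connected components from a partition\<close>

text \<open>No arc crosses the boundary of \<open>S\<close>, so an undirected walk starting at
  \<open>u\<close> never leaves \<open>S\<close>; connectedness reaches every vertex of
  \<open>H\<close> by such a walk.\<close>

lemma connected_subgraph_induce:
  assumes H: "subgraph H G" "connected H" and u: "u \<in> verts H" "u \<in> S"
    and closed: "\<And>a. a \<in> arcs G \<Longrightarrow> tail G a \<in> S \<longleftrightarrow> head G a \<in> S"
  shows "subgraph H (G \<restriction> S)"
proof -
  interpret H: wf_digraph H using H by auto
  interpret G: wf_digraph G using H by auto
  interpret M: pair_wf_digraph "mk_symmetric H" by auto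
  have ends: "tail H = tail G" "head H = head G" and "arcs H \<subseteq> arcs G"
    using H by (auto simp: subgraph_def compatible_def)
  then have step: "x \<in> S \<longleftrightarrow> y \<in> S" if "(x, y) \<in> parcs (mk_symmetric H)" for x y
    using that closed by (auto simp: parcs_mk_symmetric)
  have "v \<in> S" if "v \<in> verts H" for v
  proof -
    have "u \<rightarrow>\<^sup>*\<^bsub>mk_symmetric H\<^esub> v"
      using H(2) u(1) that by (auto simp: connected_def strongly_connected_def)
    then show "v \<in> S"
      by (induction rule: M.reachable_induct) (use u(2) step in auto)
  qed
  then show ?thesis
    using \<open>arcs H \<subseteq> arcs G\<close> ends H.wellformed G.wellformed_induce_subgraph H.wf_digraph_axioms
    by (intro subgraphI) (auto simp: compatible_def)
qed

text \<open>A connected subgraph that meets a block is trapped in it. Hence a block cannot be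
  enlarged, and a maximal connected subgraph must be the whole block that it meets.\<close>

lemma connected_components_partition:
  assumes wf: "wf_digraph G" and verts: "verts G = \<Union>P" and nonempty: "{} \<notin> P"
    and closed: "\<And>S a. S \<in> P \<Longrightarrow> a \<in> arcs G \<Longrightarrow> tail G a \<in> S \<longleftrightarrow> head G a \<in> S"
    and conn: "\<And>S. S \<in> P \<Longrightarrow> connected (G \<restriction> S)"
  shows "connected_components G = (\<restriction>) G ` P"
proof -
  interpret wf_digraph G by (rule wf)
  have sub: "subgraph (G \<restriction> S) G" if "S \<in> P" for S
    using verts that by (intro subgraph_induce_subgraphI) auto
  \<comment> \<open>Compatibility makes the tail and head functions agree everywhere, so the records
    themselves are equal.\<close>
  have antisym: "H = K" if "subgraph H K" "subgraph K H" for H K :: "('a, 'b) pre_digraph"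
    using that by (auto simp: subgraph_def compatible_def intro!: pre_digraph.equality)
  show ?thesis
  proof (intro subset_antisym subsetI)
    fix H assume "H \<in> (\<restriction>) G ` P"
    then obtain S where S: "S \<in> P" "H = G \<restriction> S" by auto
    have "H' = H" if H': "subgraph H H'" "subgraph H' G" "connected H'" for H'
    proof -
      have "S \<noteq> {}" using S(1) nonempty by metis
      then obtain u where "u \<in> S" by auto
      then have "subgraph H' H"
        using connected_subgraph_induce[OF H'(2,3), of u S] closed[OF S(1)] S(2) H'(1)
        by (auto simp: subgraph_def)
      with H'(1) show ?thesis using antisym by blast
    qed
    then show "H \<in> connected_components G"
      using S sub conn by (auto simp: connected_components_def max_subgraph_def)
  next
    fix H assume "H \<in> connected_components G"
    then have H: "subgraph H G" "connected H"
      and max: "\<And>H'. subgraph H H' \<Longrightarrow> subgraph H' G \<Longrightarrow> connected H' \<Longrightarrow> H' = H"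
      by (auto simp: connected_components_def max_subgraph_def)
    obtain u where u: "u \<in> verts H" using H(2) by (auto simp: connected_def strongly_connected_def)
    then obtain S where S: "S \<in> P" "u \<in> S" using H(1) verts by (auto simp: subgraph_def)
    have "subgraph H (G \<restriction> S)" by (rule connected_subgraph_induce[OF H u S(2)]) (use S closed in auto)
    then have "G \<restriction> S = H" using max sub conn S by auto
    then show "H \<in> (\<restriction>) G ` P" using S by auto
  qed
qed

text \<open>All vertices are joined through \<open>f 0\<close>; the symmetric closure permits
  walking the path backwards.\<close>

lemma connected_if_path:
  assumes wf: "wf_digraph G" and verts: "verts G = f ` {..<N}" and "N > 0"
    and step: "\<And>i. Suc i < N \<Longrightarrow> f i \<rightarrow>\<^bsub>G\<^esub> f (Suc i)"
  shows "connected G"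
proof -
  interpret wf_digraph G by (rule wf)
  interpret M: pair_wf_digraph "mk_symmetric G" by auto
  have fwd: "f 0 \<rightarrow>\<^sup>*\<^bsub>mk_symmetric G\<^esub> f i" if "i < N" for i
    using that
  proof (induction i)
    case 0
    then show ?case using verts by auto
  next
    case (Suc i)
    then have "f i \<rightarrow>\<^sup>*\<^bsub>mk_symmetric G\<^esub> f (Suc i)"
      using step by (intro reachable_mk_symmetricI reachable_adjI)
    with Suc show ?case using M.reachable_trans by auto
  qed
  have "f i \<rightarrow>\<^sup>*\<^bsub>mk_symmetric G\<^esub> f 0" if "i < N" for i
    using symmetric_reachable[OF symmetric_mk_symmetric fwd[OF that]] .
  then have "f i \<rightarrow>\<^sup>*\<^bsub>mk_symmetric G\<^esub> f k" if "i < N" "k < N" for i k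
    using M.reachable_trans fwd that by blast
  then show ?thesis
    using verts \<open>N > 0\<close> by (auto simp: connected_def strongly_connected_def)
qed

section \<open>States of a maximal linear recurrence\<close>

text \<open>The recurrence is shifted by \<open>n\<close>, so that it relates only the produced
  values \<open>s 0\<close>, \<open>s 1\<close>, ... and the initial values at negative indices
  disappear.\<close>

locale maximal_recurrence =
  fixes n :: nat and c s :: "nat \<Rightarrow> bit" and p :: nat
  assumes order: "n \<ge> 2"
    and rec: "\<And>k. s (k + n) = (\<Sum>i=1..n. c i * s (k + (n - i)))"
    and least: "least_period s p"
    and p_def: "p = 2 ^ n - 1"
begin

definition state :: "nat \<Rightarrow> binstring" where
  "state k = map (\<lambda>i. s (k + i)) [0..<n]"

definition costate :: "nat \<Rightarrow> binstring" where
  "costate k = map (\<lambda>i. s (k + i) + 1) [0..<n]"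

lemma length_state [simp]: "length (state k) = n" "length (costate k) = n"
  by (simp_all add: state_def costate_def)

lemma nth_state [simp]: "i < n \<Longrightarrow> state k ! i = s (k + i)" "i < n \<Longrightarrow> costate k ! i = s (k + i) + 1"
  by (simp_all add: state_def costate_def)

lemma state_eq_iff: "state k = w \<longleftrightarrow> length w = n \<and> (\<forall>i<n. s (k + i) = w ! i)"
  by (auto simp: state_def list_eq_iff_nth_eq)

lemma costate_eq_iff: "costate k = w \<longleftrightarrow> length w = n \<and> (\<forall>i<n. s (k + i) + 1 = w ! i)"
  by (auto simp: costate_def list_eq_iff_nth_eq)

lemma costate_const:
  "costate k = replicate n 0 \<longleftrightarrow> state k = replicate n 1"
  "costate k = replicate n 1 \<longleftrightarrow> state k = replicate n 0"
  by (auto simp: costate_eq_iff state_eq_iff)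

lemma p_ge: "p \<ge> 3"
proof -
  have "(2::nat) ^ 2 \<le> 2 ^ n" using order by (intro power_increasing) auto
  then show ?thesis by (simp add: p_def)
qed

lemma periodic: "s (k + p) = s k" and periodic_mult: "s (k + m * p) = s k"
proof -
  show *: "s (k + p) = s k" for k using least by (simp add: least_period_def has_period_def)
  show "s (k + m * p) = s k"
    by (induction m) (use *[of "k + _ * p"] in \<open>auto simp: algebra_simps\<close>)
qed

lemma least_le: "has_period s q \<Longrightarrow> p \<le> q"
  using least by (simp add: least_period_def)

text \<open>Each further value is computed from the \<open>n\<close> values before it, so equal
  states have equal futures.\<close>

lemma state_eq_imp_shift:
  assumes "state i = state j"
  shows "s (i + m) = s (j + m)"
proof (induction m rule: less_induct)
  case (less m)
  show ?case
  proof (cases "m < n")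
    case True
    with assms show ?thesis by (metis nth_state)
  next
    case False
    then have "s (i + (m - n) + (n - t)) = s (j + (m - n) + (n - t))" if "t \<in> {1..n}" for t
      using that order less[of "m - n + (n - t)"] by (simp add: add.assoc)
    then have "s (i + (m - n) + n) = s (j + (m - n) + n)"
      by (simp only: rec cong: sum.cong)
    with False show ?thesis by simp
  qed
qed

text \<open>A repetition at distance \<open>j - i\<close> would make \<open>j - i\<close> a period
  smaller than \<open>p\<close>.\<close>

lemma state_distinct:
  assumes "i < j" "j < i + p"
  shows "state i \<noteq> state j"
proof
  assume eq: "state i = state j"
  have "s (k + (j - i)) = s k" for k
  proof -
    \<comment> \<open>Equality of states only propagates forwards. Adding \<open>i\<close> full
      periods moves \<open>k\<close> beyond \<open>i\<close> without changing
      \<open>s k\<close>.\<close>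
    define m where "m = k + i * p - i"
    have m: "i + m = k + i * p" using p_ge by (cases p) (auto simp: m_def)
    have "s (k + (j - i)) = s (j + m)"
    proof -
      have "k + (j - i) + i * p = j + m" using m assms(1) by simp
      then show ?thesis using periodic_mult[of "k + (j - i)" i] by simp
    qed
    also have "\<dots> = s k" using state_eq_imp_shift[OF eq, of m] m periodic_mult by simp
    finally show ?thesis .
  qed
  then have "has_period s (j - i)" using assms by (simp add: has_period_def)
  then show False using least_le assms by force
qed

lemma state_Suc_neq: "state (Suc k) \<noteq> state k"
  using state_distinct[of k "Suc k"] p_ge by auto

text \<open>A homogeneous recurrence never leaves the zero state, which would make two successive
  states equal.\<close>

lemma state_nonzero: "state k \<noteq> replicate n 0"
proof
  assume zero: "state k = replicate n 0"
  have "s (k + m) = 0" for m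
  proof (induction m rule: less_induct)
    case (less m)
    show ?case
    proof (cases "m < n")
      case True
      with zero show ?thesis by (simp add: state_eq_iff)
    next
      case False
      then have "s (k + (m - n) + (n - t)) = 0" if "t \<in> {1..n}" for t
        using that order less[of "m - n + (n - t)"] by (simp add: add.assoc)
      then have "s (k + (m - n) + n) = 0"
        by (simp only: rec cong: sum.cong) simp
      with False show ?thesis by simp
    qed
  qed
  from this[of "Suc _"] this have "state (Suc k) = state k" by (simp add: state_eq_iff)
  then show False using state_Suc_neq by blast
qed

text \<open>Counting: \<open>p\<close> pairwise distinct states fill the \<open>2 ^ n - 1\<close>
  nonzero words. The free start \<open>b\<close> allows the enumeration to begin at any
  state.\<close>

lemma states_eq: "(\<lambda>i. state (b + i)) ` {..<p} = {w. length w = n} - {replicate n 0}"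
proof (rule card_subset_eq)
  have words: "finite {w :: binstring. length w = n}" "card {w :: binstring. length w = n} = 2 ^ n"
  proof -
    have UNIV: "(UNIV :: bit set) = {0, 1}" by (auto intro: bit.exhaust)
    have "finite (UNIV :: bit set)" "card (UNIV :: bit set) = 2" unfolding UNIV by auto
    then show "finite {w :: binstring. length w = n}" "card {w :: binstring. length w = n} = 2 ^ n"
      using finite_lists_length_eq[of "UNIV :: bit set" n] card_lists_length_eq[of "UNIV :: bit set" n]
      by auto
  qed
  show "finite ({w :: binstring. length w = n} - {replicate n 0})" using words by auto
  show "(\<lambda>i. state (b + i)) ` {..<p} \<subseteq> {w. length w = n} - {replicate n 0}"
    using state_nonzero by auto
  have "inj_on (\<lambda>i. state (b + i)) {..<p}"
  proof (rule linorder_inj_onI)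
    fix x y assume "x < y" "x \<in> {..<p}" "y \<in> {..<p}"
    then show "state (b + x) \<noteq> state (b + y)" by (intro state_distinct) auto
  qed auto
  then show "card ((\<lambda>i. state (b + i)) ` {..<p}) = card ({w :: binstring. length w = n} - {replicate n 0})"
    using words by (simp add: card_image p_def)
qed

lemma ex_state:
  assumes "length w = n" "w \<noteq> replicate n 0"
  obtains i where "i < p" "w = state (b + i)"
  using assms states_eq[of b] by (auto simp: set_eq_iff image_iff)

text \<open>Otherwise the all-one state would be a fixed point.\<close>

lemma sum_coefficients: "(\<Sum>i=1..n. c i) = 0"
proof (rule ccontr)
  assume sum: "(\<Sum>i=1..n. c i) \<noteq> 0"
  obtain k where "state k = replicate n 1"
    using ex_state[of "replicate n 1" 0] order by (metis add_0 length_replicate nth_replicate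
        less_le_trans pos2 zero_neq_one)
  then have one: "s (k + i) = 1" if "i < n" for i using that by (auto simp: state_eq_iff)
  then have "(\<Sum>i=1..n. c i * s (k + (n - i))) = (\<Sum>i=1..n. c i)"
  proof (intro sum.cong refl)
    fix i assume "i \<in> {1..n}"
    then have "s (k + (n - i)) = 1" by (intro one) auto
    then show "c i * s (k + (n - i)) = c i" by (simp only: mult_1_right)
  qed
  then have "s (k + n) = 1" using rec[of k] sum by simp
  then have "s (k + i) = 1" if "i \<le> n" for i using one that by (cases "i = n") auto
  then have "state (Suc k) = state k" by (auto simp: state_eq_iff) (metis Suc_leI add_Suc_right)
  then show False using state_Suc_neq by blast
qed

text \<open>By linearity, adding the all-one word changes the feedback by the sum of the
  coefficients, which is 0.\<close>

lemma costate_eq_state_next: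
  assumes "costate k = state j"
  shows "s (j + n) = s (k + n)"
proof -
  have *: "s (j + i) = s (k + i) + 1" if "i < n" for i using assms that by (simp add: costate_eq_iff)
  then have "s (j + n) = (\<Sum>i=1..n. c i * (s (k + (n - i)) + 1))"
    unfolding rec
  proof (intro sum.cong refl)
    fix i assume "i \<in> {1..n}"
    then have "s (j + (n - i)) = s (k + (n - i)) + 1" by (intro *) auto
    then show "c i * s (j + (n - i)) = c i * (s (k + (n - i)) + 1)" by (simp only:)
  qed
  also have "\<dots> = s (k + n) + (\<Sum>i=1..n. c i)"
    unfolding rec by (simp only: distrib_left mult_1_right sum.distrib)
  finally show ?thesis unfolding sum_coefficients by (simp only: add_0_right)
qed

text \<open>From the same word the recurrence appends \<open>s (k + n)\<close>, whereas the
  complemented orbit appends \<open>s (k + n) + 1\<close>.\<close>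

lemma costate_arc_neq_state_arc: "(costate k, costate (Suc k)) \<noteq> (state j, state (Suc j))"
proof
  assume eq: "(costate k, costate (Suc k)) = (state j, state (Suc j))"
  then have "costate (Suc k) ! (n - 1) = state (Suc j) ! (n - 1)" by simp
  then have "s (k + n) + 1 = s (j + n)" using order by simp
  then show False using costate_eq_state_next[of k j] eq
    by (simp only: prod.inject) (cases "s (k + n)"; simp)
qed

lemma state_Suc: "state (Suc k) = tl (state k) @ [s (k + n)]"
proof (rule nth_equalityI)
  fix i assume "i < length (state (Suc k))"
  then have "i < n - 1 \<or> i = n - 1" by auto
  then show "state (Suc k) ! i = (tl (state k) @ [s (k + n)]) ! i"
    using order by (auto simp: nth_append nth_tl)
qed (use order in simp)

lemma state_Cons: "state k = s k # tl (state k)"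
  using order by (simp add: state_def map_tl upt_conv_Cons)

end

section \<open>The linear DeBruijn cycle and its complement\<close>

text \<open>The index \<open>j\<close> marks the start of the run of \<open>n - 1\<close> zeros in
  front of which the extra zero is inserted.\<close>

locale linear_cycle = maximal_recurrence +
  fixes j :: nat
  assumes zero_run: "i < n - 1 \<Longrightarrow> s (j + i) = 0"
begin

definition cycle_word :: binstring where
  "cycle_word = 0 # map (\<lambda>i. s (j + i)) [0..<p]"

definition cycle_window :: "nat \<Rightarrow> binstring" where
  "cycle_window q = map (\<lambda>t. cycle_word ! ((q + t) mod 2 ^ n)) [0..<n]"

lemma Suc_p: "Suc p = 2 ^ n"
  by (simp add: p_def)

lemma order_less_p: "n \<le> p"
  using less_exp[of n] Suc_p by linarith

lemma length_cycle_word: "length cycle_word = 2 ^ n"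
  using Suc_p by (simp add: cycle_word_def)

lemma nth_cycle_word_Suc: "i < p \<Longrightarrow> cycle_word ! Suc i = s (j + i)"
  by (simp add: cycle_word_def)

text \<open>The inserted zero is followed by the run of zeros starting at \<open>j\<close>.\<close>

lemma cycle_window_0: "cycle_window 0 = replicate n 0"
proof -
  have "cycle_word ! (t mod 2 ^ n) = 0" if "t < n" for t
  proof (cases t)
    case (Suc i)
    then show ?thesis
      using that order_less_p zero_run[of i] nth_cycle_word_Suc[of i] Suc_p by auto
  qed (simp add: cycle_word_def)
  then show ?thesis by (auto simp: cycle_window_def list_eq_iff_nth_eq)
qed

text \<open>The inserted zero shifts positions by one. A window that wraps around lags one place
  behind the sequence, but there both read only zeros of the run.\<close>

lemma cycle_window_Suc:
  assumes "q < p"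
  shows "cycle_window (Suc q) = state (j + q)"
proof -
  have "cycle_word ! ((Suc q + t) mod 2 ^ n) = s (j + q + t)" if "t < n" for t
  proof -
    \<comment> \<open>The digit lies before the wrap, is the inserted zero, or lies after it. In the
      last case the cycle word shows \<open>s (j + u)\<close> where the sequence has
      \<open>s (j + Suc u)\<close>.\<close>
    consider "q + t < p" | "q + t = p" | u where "q + t = p + Suc u" "Suc u < n - 1"
    proof -
      have "q + t = p + Suc (q + t - p - 1)" "Suc (q + t - p - 1) < n - 1" if "q + t > p"
        using that \<open>q < p\<close> \<open>t < n\<close> by auto
      then show ?thesis using that by (metis linorder_neqE_nat)
    qed
    then show ?thesis
    proof cases
      case 1
      then show ?thesis using nth_cycle_word_Suc Suc_p by (simp add: add.assoc)
    next
      case 2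
      then have "s (j + q + t) = s (j + 0)" using periodic[of j] by (simp add: ac_simps)
      also have "\<dots> = 0" using order by (intro zero_run) auto
      moreover have "(Suc q + t) mod 2 ^ n = 0" using 2 Suc_p by simp
      ultimately show ?thesis by (simp add: cycle_word_def)
    next
      case 3
      have "Suc q + t = Suc p + Suc u" using 3 by simp
      then have "(Suc q + t) mod 2 ^ n = Suc u"
        using 3 order_less_p unfolding Suc_p[symmetric] by (simp only: mod_add_self1) simp
      moreover have "cycle_word ! Suc u = 0"
        using 3 order_less_p by (simp add: nth_cycle_word_Suc zero_run)
      moreover have "s (j + q + t) = s (j + Suc u)"
        using periodic[of "j + Suc u"] 3 by (simp add: ac_simps)
      ultimately show ?thesis using 3 zero_run[of "Suc u"] by simp
    qed
  qed
  then show ?thesis by (simp add: cycle_window_def state_def)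
qed

section \<open>Windows of an associated string and the arcs of its circuit\<close>

lemma cycle_window_mod: "q mod 2 ^ n = r mod 2 ^ n \<Longrightarrow> cycle_window q = cycle_window r"
  unfolding cycle_window_def by (metis mod_add_left_eq)

text \<open>The appended \<open>n - 1\<close> digits continue the cyclic reading past the end, so
  the rotation only shifts the index by \<open>m\<close>.\<close>

lemma window_eq_cycle_window:
  assumes X: "X = rotate m cycle_word @ take (n - 1) (rotate m cycle_word)" and i: "i < 2 ^ n"
  shows "window n X i = cycle_window (i + m)"
proof -
  have len: "length X = 2 ^ n + (n - 1)"
    using order_less_p Suc_p by (simp add: X length_cycle_word)
  have nth: "X ! t = cycle_word ! ((t + m) mod 2 ^ n)" if t: "t < 2 ^ n + (n - 1)" for t
  proof (cases "t < 2 ^ n")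
    case True
    then show ?thesis by (simp add: X nth_append length_cycle_word nth_rotate add.commute)
  next
    case False
    have "n - 1 < 2 ^ n" using order_less_p Suc_p by linarith
    then have "X ! t = cycle_word ! ((t - 2 ^ n + m) mod 2 ^ n)"
      using False t by (simp add: X nth_append length_cycle_word nth_rotate add.commute)
    also have "(t - 2 ^ n + m) mod 2 ^ n = (2 ^ n + (t - 2 ^ n + m)) mod 2 ^ n"
      by (simp only: mod_add_self1)
    also have "2 ^ n + (t - 2 ^ n + m) = t + m" using False by simp
    finally show ?thesis .
  qed
  show ?thesis
  proof (rule nth_equalityI)
    show "length (window n X i) = length (cycle_window (i + m))"
      using i len order by (simp add: window_def cycle_window_def)
    fix t assume "t < length (window n X i)"
    then have "t < n" by (simp add: window_def)
    then show "window n X i ! t = cycle_window (i + m) ! t"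
      using i len order nth[of "i + t"]
      by (simp add: window_def cycle_window_def ac_simps)
  qed
qed

lemma ex_window:
  assumes X: "X = rotate m cycle_word @ take (n - 1) (rotate m cycle_word)"
  obtains i where "i < 2 ^ n" "window n X i = cycle_window q"
    "window n X (Suc i mod 2 ^ n) = cycle_window (Suc q)"
proof
  \<comment> \<open>Since \<open>p\<close> is -1 modulo \<open>2 ^ n\<close>, adding
    \<open>m * p\<close> undoes the rotation by \<open>m\<close> without subtraction.\<close>
  define i where "i = (q + m * p) mod 2 ^ n"
  show i: "i < 2 ^ n" by (simp add: i_def)
  have mod: "(i + m + r) mod 2 ^ n = (q + r) mod 2 ^ n" for r
  proof -
    have "(i + m + r) mod 2 ^ n = (q + m * p + m + r) mod 2 ^ n"
      unfolding i_def by (simp only: add.assoc mod_add_left_eq)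
    also have "q + m * p + m + r = q + r + m * 2 ^ n"
      unfolding Suc_p[symmetric] by simp
    finally show ?thesis by simp
  qed
  show "window n X i = cycle_window q"
    unfolding window_eq_cycle_window[OF X i] using mod[of 0] by (intro cycle_window_mod) simp
  have "(Suc i mod 2 ^ n + m) mod 2 ^ n = Suc q mod 2 ^ n"
    using mod[of 1] by (simp add: mod_add_left_eq)
  then show "window n X (Suc i mod 2 ^ n) = cycle_window (Suc q)"
    by (subst window_eq_cycle_window[OF X]) (auto intro!: cycle_window_mod)
qed

lemma deBruijn_string_cycle:
  assumes X: "X = rotate m cycle_word @ take (n - 1) (rotate m cycle_word)"
  shows "deBruijn_string n X"
proof -
  have "sublist w X" if w: "length w = n" for w
  proof -
    obtain q where "w = cycle_window q"
    proof (cases "w = replicate n 0")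
      case True
      then show ?thesis using that[of 0] cycle_window_0 by simp
    next
      case False
      then obtain i where "i < p" "w = state (j + i)" using ex_state[OF w False] by metis
      then show ?thesis using that[of "Suc i"] cycle_window_Suc by simp
    qed
    moreover obtain i where "window n X i = cycle_window q" by (rule ex_window[OF X])
    ultimately have "w = window n X i" by simp
    then show ?thesis
      unfolding window_def using sublist_order.order_trans[OF sublist_take sublist_drop] by simp
  qed
  moreover have "length X = 2 ^ n + n - 1"
    using order order_less_p Suc_p unfolding X by (simp add: length_cycle_word)
  ultimately show ?thesis by (simp add: deBruijn_string_def)
qed

text \<open>The rotation drops out. The circuit is the closed orbit of the recurrence in which the
  arc from \<open>state (j + (p - 1))\<close> back to \<open>state j\<close> is replaced by the
  detour through the zero word.\<close>

lemma circuit_arcs_cycle: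
  assumes X: "X = rotate m cycle_word @ take (n - 1) (rotate m cycle_word)"
  shows "circuit_arcs n X =
    {(replicate n 0, state j), (state (j + (p - 1)), replicate n 0)}
    \<union> {(state (j + q), state (Suc (j + q))) | q. Suc q < p}"
proof -
  have "circuit_arcs n X = {(cycle_window q, cycle_window (Suc q)) | q. q < 2 ^ n}"
  proof (intro subset_antisym subsetI)
    fix a assume "a \<in> circuit_arcs n X"
    then obtain i where i: "i < 2 ^ n" "a = (window n X i, window n X (Suc i mod 2 ^ n))"
      by (auto simp: circuit_arcs_def)
    have "window n X i = cycle_window ((i + m) mod 2 ^ n)"
      "window n X (Suc i mod 2 ^ n) = cycle_window (Suc ((i + m) mod 2 ^ n))"
      using i by (auto simp: window_eq_cycle_window[OF X] mod_add_left_eq mod_Suc_eq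
          intro!: cycle_window_mod)
    moreover have "(i + m) mod 2 ^ n < 2 ^ n" by simp
    ultimately show "a \<in> {(cycle_window q, cycle_window (Suc q)) | q. q < 2 ^ n}"
      using i by blast
  next
    fix a assume "a \<in> {(cycle_window q, cycle_window (Suc q)) | q. q < 2 ^ n}"
    then obtain q where "a = (cycle_window q, cycle_window (Suc q))" by auto
    moreover obtain i where "i < 2 ^ n" "window n X i = cycle_window q"
      "window n X (Suc i mod 2 ^ n) = cycle_window (Suc q)"
      by (rule ex_window[OF X])
    ultimately have "i < 2 ^ n \<and> a = (window n X i, window n X (Suc i mod 2 ^ n))" by simp
    then show "a \<in> circuit_arcs n X" unfolding circuit_arcs_def by blast
  qed
  also have "\<dots> = {(replicate n 0, state j), (state (j + (p - 1)), replicate n 0)}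
    \<union> {(state (j + q), state (Suc (j + q))) | q. Suc q < p}" (is "?L = ?R")
  proof -
    have first: "cycle_window (Suc 0) = state j" using p_ge cycle_window_Suc[of 0] by simp
    have last: "cycle_window p = state (j + (p - 1))"
      using p_ge cycle_window_Suc[of "p - 1"] by simp
    have wrap: "cycle_window (Suc p) = replicate n 0"
      using cycle_window_0 cycle_window_mod[of "Suc p" 0] Suc_p by simp
    have inner: "cycle_window (Suc q) = state (j + q)"
      "cycle_window (Suc (Suc q)) = state (Suc (j + q))" if "Suc q < p" for q
      using that cycle_window_Suc[of q] cycle_window_Suc[of "Suc q"] by auto
    show ?thesis
    proof (intro subset_antisym subsetI)
      fix a assume "a \<in> ?L"
      then obtain q where q: "q < 2 ^ n" "a = (cycle_window q, cycle_window (Suc q))" by blast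
      \<comment> \<open>Window 0 is the zero word and window \<open>p\<close> its predecessor; all
        other arcs belong to the recurrence.\<close>
      consider "q = 0" | "q = p" | r where "q = Suc r" "Suc r < p"
        using q(1) unfolding Suc_p[symmetric] by (cases q) (auto simp: less_Suc_eq)
      then show "a \<in> ?R"
      proof cases
        case 3
        then have "a = (state (j + r), state (Suc (j + r)))" using q(2) inner[of r] by simp
        with 3(2) show ?thesis by blast
      qed (simp_all add: q(2) first last wrap cycle_window_0)
    next
      have L: "(cycle_window q, cycle_window (Suc q)) \<in> ?L" if "q < Suc p" for q
        using that unfolding Suc_p by blast
      fix a assume "a \<in> ?R"
      then consider "a = (replicate n 0, state j)" | "a = (state (j + (p - 1)), replicate n 0)"
        | q where "a = (state (j + q), state (Suc (j + q)))" "Suc q < p" by blast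
      then show "a \<in> ?L"
      proof cases
        case 1
        then show ?thesis using L[of 0] by (simp only: first cycle_window_0)
      next
        case 2
        then show ?thesis using L[of p] by (simp only: last wrap)
      next
        case 3
        then show ?thesis using L[of "Suc q"] inner[OF 3(2)] by simp
      qed
    qed
  qed
  finally show ?thesis .
qed

section \<open>The neighbours of the zero word on the circuit\<close>

lemma state_j: "state j = replicate (n - 1) 0 @ [1]"
proof -
  have prefix: "state j ! i = (replicate (n - 1) 0 @ [1]) ! i" if "i < n - 1" for i
    using that zero_run by (simp add: nth_append)
  have "s (j + (n - 1)) \<noteq> 0"
  proof
    assume "s (j + (n - 1)) = 0"
    then have "s (j + i) = 0" if "i < n" for i using that zero_run[of i] by (cases "i = n - 1") auto
    then show False using state_nonzero[of j] by (simp add: state_eq_iff)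
  qed
  then have "state j ! i = (replicate (n - 1) 0 @ [1]) ! i" if "i < n" for i
    using that prefix[of i] order by (cases "i = n - 1") (auto simp: nth_append)
  then show ?thesis using order by (simp add: list_eq_iff_nth_eq)
qed

text \<open>One period after \<open>j\<close> the run of zeros recurs and fills all places but the
  first; a 0 there would give the zero state.\<close>

lemma state_j_pred: "state (j + (p - 1)) = 1 # replicate (n - 1) 0"
proof -
  have suffix: "s (j + (p - 1) + i) = 0" if i: "i < n" "i \<noteq> 0" for i
  proof -
    have "j + (p - 1) + i = j + (i - 1) + p" using i p_ge by simp
    moreover have "s (j + (i - 1)) = 0" using i by (intro zero_run) auto
    ultimately show ?thesis using periodic[of "j + (i - 1)"] by (simp only:)
  qed
  have "s (j + (p - 1)) \<noteq> 0"
  proof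
    assume "s (j + (p - 1)) = 0"
    then have "s (j + (p - 1) + i) = 0" if "i < n" for i using that suffix by (cases "i = 0") auto
    then show False using state_nonzero[of "j + (p - 1)"] by (simp add: state_eq_iff)
  qed
  then show ?thesis
    using suffix[of "Suc _"] order by (auto simp: state_eq_iff nth_Cons split: nat.split)
qed

lemma snoc_eq_replicate: "r @ [y] = replicate n x \<longleftrightarrow> r = replicate (n - 1) x \<and> y = x"
proof -
  obtain k where k: "n = Suc k" using order by (cases n) auto
  have "replicate n x = replicate k x @ [x]" by (simp add: k replicate_append_same)
  then show ?thesis using k by simp
qed

lemma zero_neq_one_word: "replicate n (0 :: bit) \<noteq> replicate n 1"
  using order by (cases n) auto

section \<open>Arcs and components left after removing the circuit\<close>

context
  fixes X m
  assumes X: "X = rotate m cycle_word @ take (n - 1) (rotate m cycle_word)"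
begin

lemma complement_arcs_iff:
  "(u, v) \<in> parcs (complement_graph n X) \<longleftrightarrow>
    length u = n \<and> (\<exists>y. v = tl u @ [y]) \<and> (u, v) \<notin> circuit_arcs n X"
proof -
  have "(u, v) \<in> parcs (deBruijn_graph n) \<longleftrightarrow> length u = n \<and> (\<exists>y. v = tl u @ [y])"
    using order by (cases u) (auto simp: deBruijn_graph_def)
  then show ?thesis by (simp add: complement_graph_def)
qed

lemma wf_complement: "wf_digraph (with_proj (complement_graph n X))"
proof -
  have "pair_wf_digraph (complement_graph n X)"
    by unfold_locales (use order in \<open>auto simp: complement_graph_def deBruijn_graph_def\<close>)
  then show ?thesis by (simp add: wf_digraph_wp_iff)
qed

lemma zero_loop: "(replicate n 0, replicate n 0) \<in> parcs (complement_graph n X)"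
proof -
  have "(replicate n 0, replicate n 0) \<notin> circuit_arcs n X"
    by (auto simp: circuit_arcs_cycle[OF X] state_nonzero state_nonzero[symmetric])
  moreover have "tl (replicate n 0) @ [0] = replicate n (0 :: bit)" by (simp add: snoc_eq_replicate)
  ultimately show ?thesis unfolding complement_arcs_iff by (metis length_replicate)
qed

lemma one_loop: "(replicate n 1, replicate n 1) \<in> parcs (complement_graph n X)"
proof -
  have "(replicate n 1, replicate n 1) \<notin> circuit_arcs n X"
  proof
    assume "(replicate n 1, replicate n 1) \<in> circuit_arcs n X"
    then obtain q where "replicate n 1 = state (j + q)" "replicate n 1 = state (Suc (j + q))"
      using zero_neq_one_word by (auto simp: circuit_arcs_cycle[OF X])
    then show False using state_Suc_neq by metis
  qed
  moreover have "tl (replicate n 1) @ [1] = replicate n (1 :: bit)" by (simp add: snoc_eq_replicate)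
  ultimately show ?thesis unfolding complement_arcs_iff by (metis length_replicate)
qed

text \<open>Apart from its loop, the zero word has one outgoing and one incoming arc, and the detour
  of the circuit uses both.\<close>

lemma zero_isolated:
  assumes "(u, v) \<in> parcs (complement_graph n X)"
  shows "u = replicate n 0 \<longleftrightarrow> v = replicate n 0"
proof
  assume u: "u = replicate n 0"
  from assms obtain y where y: "v = tl u @ [y]" "(u, v) \<notin> circuit_arcs n X"
    by (auto simp: complement_arcs_iff)
  have "v \<noteq> state j" using y u by (auto simp: circuit_arcs_cycle[OF X])
  then have "y = 0" using y(1) u state_j by (cases y) auto
  then show "v = replicate n 0" using y(1) u by (simp add: snoc_eq_replicate)
next
  assume v: "v = replicate n 0"
  from assms obtain y where y: "length u = n" "v = tl u @ [y]" "(u, v) \<notin> circuit_arcs n X"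
    by (auto simp: complement_arcs_iff)
  then obtain x r where u: "u = x # r" using order by (cases u) auto
  have r: "r = replicate (n - 1) 0"
    using y(2) v u snoc_eq_replicate[of r y 0] by simp
  have "u \<noteq> state (j + (p - 1))" using y v by (auto simp: circuit_arcs_cycle[OF X])
  then have "x = 0" using u r state_j_pred by (cases x) auto
  then show "u = replicate n 0"
    using u r order by (cases n) auto
qed

text \<open>The all-one word also has only one arc out and one arc in besides its loop. The circuit
  visits it without using the loop, so it takes both.\<close>

lemma one_isolated:
  assumes "(u, v) \<in> parcs (complement_graph n X)"
  shows "u = replicate n 1 \<longleftrightarrow> v = replicate n 1"
proof -
  obtain q where "q < p" "replicate n 1 = state (j + q)"
    using ex_state[of "replicate n 1" j] zero_neq_one_word by (metis length_replicate)
  then have one: "state (j + q) = replicate n 1" by simp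
  have ones: "s (j + q + i) = 1" if "i < n" for i using one that by (simp add: state_eq_iff)
  \<comment> \<open>The first and the last state of the orbit contain a 0, so both circuit arcs at
    the all-one word come from the recurrence and not from the detour.\<close>
  have "q \<noteq> 0" using ones[of 0] zero_run[of 0] order by (cases "q = 0") auto
  moreover have "q \<noteq> p - 1"
    using ones[of 1] order arg_cong[OF state_j_pred, of "\<lambda>v. v ! 1"] by auto
  ultimately have "Suc q < p" using \<open>q < p\<close> by simp
  define k where "k = j + (q - 1)"
  have k: "Suc k = j + q" using \<open>q \<noteq> 0\<close> by (simp add: k_def)
  have arc: "(state (j + r), state (Suc (j + r))) \<in> circuit_arcs n X" if "Suc r < p" for r
    unfolding circuit_arcs_cycle[OF X] using that by (intro UnI2 CollectI exI[of _ r]) simp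
  have out: "(state (j + q), state (Suc (j + q))) \<in> circuit_arcs n X"
    using \<open>Suc q < p\<close> by (rule arc)
  have inn: "(state k, state (j + q)) \<in> circuit_arcs n X"
    using arc[of "q - 1", folded k_def] \<open>Suc q < p\<close> by (simp add: k)
  show ?thesis
  proof
    assume u: "u = replicate n 1"
    from assms obtain y where y: "v = tl u @ [y]" "(u, v) \<notin> circuit_arcs n X"
      by (auto simp: complement_arcs_iff)
    have "y \<noteq> s (j + q + n)" using y u out one state_Suc[of "j + q"] by auto
    moreover have "s (j + q + n) \<noteq> 1"
    proof
      assume "s (j + q + n) = 1"
      then have "state (Suc (j + q)) = replicate n 1"
        using one by (simp add: state_Suc snoc_eq_replicate)
      then show False using state_Suc_neq[of "j + q"] one by simp
    qed
    ultimately have "y = 1" by simp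
    then show "v = replicate n 1" using y(1) u by (simp add: snoc_eq_replicate)
  next
    assume v: "v = replicate n 1"
    from assms obtain y where y: "length u = n" "v = tl u @ [y]" "(u, v) \<notin> circuit_arcs n X"
      by (auto simp: complement_arcs_iff)
    have "tl u @ [y] = tl (state k) @ [s (k + n)]"
      using y v one state_Suc[of k] by (simp add: k)
    then have tl: "tl u = tl (state k)" by simp
    have u: "u = hd u # tl u" using y(1) order by (cases u) auto
    \<comment> \<open>The two predecessors of the all-one word differ only in their first digit. The
      circuit uses \<open>state k\<close>, which is not all-one, so \<open>u\<close> must be the
      all-one word.\<close>
    have "u \<noteq> state k" using y v inn one by auto
    then have "hd u \<noteq> s k" using u tl state_Cons[of k] by metis
    moreover have ones_k: "tl (state k) = replicate (n - 1) 1"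
      using one by (simp add: state_Suc snoc_eq_replicate flip: k)
    moreover have "s k \<noteq> 1"
    proof -
      have "state k \<noteq> replicate n 1" using state_Suc_neq[of k] one by (simp add: k)
      moreover have "1 # replicate (n - 1) 1 = replicate n (1 :: bit)"
        using order by (cases n) auto
      ultimately show ?thesis using state_Cons[of k] ones_k by metis
    qed
    ultimately have "hd u = 1" "tl u = replicate (n - 1) 1" using tl by (cases "hd u"; simp)+
    then show "u = replicate n 1" using u order by (cases n) auto
  qed
qed

text \<open>Complementing the nonzero words gives all words but the all-one word. At index
  \<open>k\<close> the costate is the zero word, so starting just after it and stopping after
  \<open>p - 1\<close> steps omits exactly that word.\<close>

lemma rest_eq_costates:
  assumes one: "state k = replicate n 1"
  shows "{w. length w = n} - {replicate n 0, replicate n 1} = (\<lambda>i. costate (Suc k + i)) ` {..<p - 1}"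
proof (intro subset_antisym subsetI)
  fix w :: binstring assume "w \<in> {w. length w = n} - {replicate n 0, replicate n 1}"
  then have w: "length w = n" "w \<noteq> replicate n 0" "w \<noteq> replicate n 1" by auto
  have "map (\<lambda>b. b + 1) w \<noteq> replicate n 0"
  proof
    assume "map (\<lambda>b. b + 1) w = replicate n 0"
    then have "w ! t + 1 = 0" if "t < n" for t
      using that w(1) nth_map[of t w "\<lambda>b. b + 1"] by simp
    then have "w = replicate n 1"
      using w(1) by (auto simp: list_eq_iff_nth_eq)
    with w show False by simp
  qed
  then obtain i where i: "i < p" "map (\<lambda>b. b + 1) w = state (k + i)"
    using ex_state[of "map (\<lambda>b. b + 1) w" k] w(1) by auto
  have nth: "w ! t + 1 = s (k + i + t)" if "t < n" for t
    using i(2)[THEN arg_cong, of "\<lambda>v. v ! t"] that w(1) by simp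
  have "w ! t = s (k + i + t) + 1" if "t < n" for t
    unfolding nth[OF that, symmetric] by simp
  then have costate: "w = costate (k + i)" using w(1) by (auto simp: list_eq_iff_nth_eq)
  \<comment> \<open>Index 0 would give the costate of the all-one state, which is the zero
    word.\<close>
  have "i \<noteq> 0"
    using costate w(2) one costate_const(1)[of k] by (cases "i = 0") simp_all
  then have "w = costate (Suc k + (i - 1))" "i - 1 \<in> {..<p - 1}" using costate i by auto
  then show "w \<in> (\<lambda>i. costate (Suc k + i)) ` {..<p - 1}" by blast
next
  fix w assume "w \<in> (\<lambda>i. costate (Suc k + i)) ` {..<p - 1}"
  then obtain i where i: "i < p - 1" "w = costate (Suc k + i)" by auto
  have "state k \<noteq> state (Suc k + i)" using i by (intro state_distinct) auto
  then have "w \<noteq> replicate n 0" using one unfolding i(2) costate_const by simp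
  moreover have "w \<noteq> replicate n 1" unfolding i(2) costate_const by (rule state_nonzero)
  ultimately show "w \<in> {w. length w = n} - {replicate n 0, replicate n 1}" using i(2) by simp
qed

text \<open>Both arcs of the detour have the zero word as an end, and every other circuit arc
  follows the recurrence, which \<open>costate_arc_neq_state_arc\<close> excludes.\<close>

lemma costate_arc:
  assumes "costate k \<noteq> replicate n 0" "costate (Suc k) \<noteq> replicate n 0"
  shows "(costate k, costate (Suc k)) \<in> parcs (complement_graph n X)"
proof -
  have "costate (Suc k) = tl (costate k) @ [s (k + n) + 1]"
  proof (rule nth_equalityI)
    fix i assume "i < length (costate (Suc k))"
    then have "i < n - 1 \<or> i = n - 1" by auto
    then show "costate (Suc k) ! i = (tl (costate k) @ [s (k + n) + 1]) ! i"
      using order by (auto simp: nth_append nth_tl)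
  qed (use order in simp)
  moreover have "(costate k, costate (Suc k)) \<notin> circuit_arcs n X"
    using assms costate_arc_neq_state_arc[of k] unfolding circuit_arcs_cycle[OF X] by blast
  ultimately show ?thesis by (simp add: complement_arcs_iff)
qed

lemma rest_connected:
  "connected (with_proj (complement_graph n X) \<restriction> ({w. length w = n} - {replicate n 0, replicate n 1}))"
    (is "connected (?G \<restriction> ?R)")
proof -
  obtain k where one: "state k = replicate n 1"
    using ex_state[of "replicate n 1" 0] zero_neq_one_word by (metis length_replicate)
  let ?f = "\<lambda>i. costate (Suc k + i)"
  have R: "?R = ?f ` {..<p - 1}" by (rule rest_eq_costates[OF one])
  show ?thesis
  proof (rule connected_if_path)
    show "wf_digraph (?G \<restriction> ?R)" by (rule wf_digraph.wellformed_induce_subgraph[OF wf_complement])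
    show "verts (?G \<restriction> ?R) = ?f ` {..<p - 1}" using R by simp
    show "0 < p - 1" using p_ge by simp
    fix i assume i: "Suc i < p - 1"
    have "?f i \<in> ?R" "?f (Suc i) \<in> ?R" unfolding R by (intro imageI; use i in simp)+
    moreover from this have "(?f i, ?f (Suc i)) \<in> parcs (complement_graph n X)"
      using costate_arc[of "Suc k + i"] by simp
    ultimately show "?f i \<rightarrow>\<^bsub>?G \<restriction> ?R\<^esub> ?f (Suc i)"
      by (auto simp: arcs_ends_conv image_iff)
  qed
qed

lemma loop_component:
  assumes "(v, v) \<in> parcs G"
  shows "with_proj G \<restriction> {v} = with_proj (loop_graph v)" "connected (with_proj G \<restriction> {v})"
proof -
  show eq: "with_proj G \<restriction> {v} = with_proj (loop_graph v)"
    using assms by (auto simp: induce_subgraph_def with_proj_def loop_graph_def)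
  show "connected (with_proj G \<restriction> {v})"
    unfolding eq by (rule connected_if_path[where f = "\<lambda>_. v" and N = 1])
      (auto simp: wf_digraph_def loop_graph_def)
qed

lemma double_helix_cycle: "double_helix n X"
proof -
  let ?G = "with_proj (complement_graph n X)"
  let ?zero = "replicate n 0 :: binstring" and ?one = "replicate n 1 :: binstring"
  let ?R = "{w. length w = n} - {?zero, ?one}"
  let ?P = "{{?zero}, {?one}, ?R}"
  \<comment> \<open>A connected graph has a vertex by definition.\<close>
  have R: "?R \<noteq> {}"
    using rest_connected by (auto simp: connected_def strongly_connected_def)
  have comps: "connected_components ?G = (\<restriction>) ?G ` ?P"
  proof (rule connected_components_partition[OF wf_complement])
    show "verts ?G = \<Union>?P" by (auto simp: complement_graph_def deBruijn_graph_def)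
    show "{} \<notin> ?P" using R by auto
    fix S assume S: "S \<in> ?P"
    show "connected (?G \<restriction> S)"
      using S rest_connected loop_component(2)[OF zero_loop] loop_component(2)[OF one_loop] by auto
    fix a assume "a \<in> arcs ?G"
    then have a: "(fst a, snd a) \<in> parcs (complement_graph n X)" by simp
    then have "length (fst a) = n" "length (snd a) = n"
      using order unfolding complement_arcs_iff by auto
    then show "tail ?G a \<in> S \<longleftrightarrow> head ?G a \<in> S"
      using S zero_isolated[OF a] one_isolated[OF a] by auto
  qed
  \<comment> \<open>Each block is recovered as the vertex set of its induced subgraph, so distinct
    blocks give distinct components.\<close>
  have "inj_on ((\<restriction>) ?G) ?P" by (rule inj_onI) (metis induce_subgraph_verts)
  then have "card (connected_components ?G) = card ?P" unfolding comps by (rule card_image)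
  also have "\<dots> = 3"
  proof -
    have "{?zero} \<noteq> {?one}" "{?zero} \<noteq> ?R" "{?one} \<noteq> ?R" using zero_neq_one_word by auto
    then show ?thesis by (subst card_insert_disjoint; simp)+
  qed
  finally show ?thesis
    using loop_component(1)[OF zero_loop] loop_component(1)[OF one_loop] deBruijn_string_cycle[OF X]
    unfolding double_helix_def comps by auto
qed

end

end

section \<open>Reduction of an arbitrary linear DeBruijn sequence to the locale
  \<open>linear_cycle\<close>\<close>

theorem theorem4p2:
  fixes n :: nat and X :: "bit list"
  assumes "n \<ge> 2" and "linear_deBruijn_sequence n X"
  shows "double_helix n X"
proof -
  from assms(2) obtain s W j m m' where PN: "PN_sequence n s"
    and W: "W = rotate j (map s [0..<2 ^ n - 1])" "take (n - 1) W = replicate (n - 1) 0"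
    and X: "X = rotate m' (rotate m (0 # W)) @ take (n - 1) (rotate m' (rotate m (0 # W)))"
    unfolding linear_deBruijn_sequence_def linear_deBruijn_cycle_def associated_string_def by blast
  from PN obtain c a where rec: "linear_recurrence n c a" and s: "s = (\<lambda>k. a (int k))"
    and least: "least_period s (2 ^ n - 1)"
    unfolding PN_sequence_def by blast
  interpret maximal_recurrence n c s "2 ^ n - 1"
  proof
    fix k
    \<comment> \<open>At index \<open>k + n\<close> the recurrence reaches back at most to
      \<open>k\<close>, so every value of \<open>a\<close> involved is a value of
      \<open>s\<close>.\<close>
    have "s (k + n) = (\<Sum>i=1..n. c i * a (int (k + n) - int i))"
      using rec[unfolded linear_recurrence_def, rule_format, of "int (k + n)"]
      by (simp only: s of_nat_0_le_iff)
    also have "\<dots> = (\<Sum>i=1..n. c i * s (k + (n - i)))"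
    proof (rule sum.cong)
      fix i assume "i \<in> {1..n}"
      then have "int (k + n) - int i = int (k + (n - i))" by auto
      then show "c i * a (int (k + n) - int i) = c i * s (k + (n - i))" by (simp only: s)
    qed simp
    finally show "s (k + n) = (\<Sum>i=1..n. c i * s (k + (n - i)))" .
  qed (use assms(1) least in auto)
  \<comment> \<open>Rotation reduces indices modulo the period; periodicity removes the reduction,
    so \<open>W\<close> reads the sequence from index \<open>j\<close>, however large
    \<open>j\<close> is.\<close>
  have nth_W: "W = map (\<lambda>i. s (j + i)) [0..<2 ^ n - 1]"
  proof (rule nth_equalityI)
    fix i assume "i < length W"
    then have i: "i < 2 ^ n - 1" by (simp add: W)
    have "s ((j + i) mod (2 ^ n - 1)) = s (j + i)"
      using periodic_mult[of "(j + i) mod (2 ^ n - 1)" "(j + i) div (2 ^ n - 1)"]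
      by (simp only: mod_mult_div_eq add.commute[of "_ mod _"] div_mult_mod_eq)
    then show "W ! i = map (\<lambda>i. s (j + i)) [0..<2 ^ n - 1] ! i"
      using i by (simp add: W(1) nth_rotate)
  qed (simp add: W)
  interpret linear_cycle n c s "2 ^ n - 1" j
  proof
    fix i assume i: "i < n - 1"
    then have "W ! i = 0" using W(2) by (metis nth_replicate nth_take)
    moreover have "i < 2 ^ n - 1" using less_exp[of n] i by linarith
    ultimately show "s (j + i) = 0" using i by (simp add: nth_W)
  qed
  \<comment> \<open>The rotation that represents the cycle and the one that chooses the starting
    point of the string combine into a rotation by \<open>m' + m\<close>.\<close>
  have "cycle_word = 0 # W" by (simp only: cycle_word_def nth_W)
  with X show ?thesis by (intro double_helix_cycle[of X "m' + m"]) (simp only: rotate_rotate)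
qed

end
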